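(* Let $m\ge 3$ and let $A,B_1,\ldots,B_m$ be bounded selfadjoint operators on a complex Hilbert space $\mathcal{H}$. Assume that $\{B_1,\ldots,B_m\}$ is strongly indefinite. Then $$\langle Ax,x\rangle\ge 0\ \text{ for every } x\in\bigcap_{i=1}^m Q_i$$ if and only if the set $$\Omega=\Big\{(\lambda_1,\ldots,\lambda_m)\in\mathbb{R}^m : A+\sum_{i=1}^m\lambda_iB_i\ge 0\Big\}$$ is nonempty.
   Context: $(\mathcal{H},\langle\cdot,\cdot\rangle)$ is a complex Hilbert space. For a bounded selfadjoint operator $T$, $T\ge 0$ means $\langle Tx,x\rangle\ge 0$ for all $x\in\mathcal{H}$. $T$ is indefinite if there exist $x_+,x_-\in\mathcal{H}$ with $\langle Tx_+,x_+\rangle>0$ and $\langle Tx_-,x_-\rangle<0$. For selfadjoint $B_1,\ldots,B_m$ put $Q_p=\{x\in\mathcal{H}:\langle B_px,x\rangle=0\}$, $\mathcal{P}_p^+=\{x\in\mathcal{H}:\langle B_px,x\rangle>0\}$, $\mathcal{P}_p^-=\{x\in\mathcal{H}:\langle B_px,x\rangle<0\}$. $\{B_1,\ldots,B_m\}$ (regarded as a family indexed by $1,\ldots,m$) is weakly indefinite if $\sum_{p=1}^m\mu_pB_p$ is indefinite for every $(\mu_1,\ldots,\mu_m)\in\mathbb{R}^m\setminus\{0\}$. For $m\ge2$, $\{B_1,\ldots,B_m\}$ is strongly indefinite if (1) it is weakly indefinite; and (2) for all $p,j,k\in\{1,\ldots,m\}$ and all $x_+\in\mathcal{P}_p^+\cap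 Q_j\cap Q_k$, $x_-\in\mathcal{P}_p^-\cap Q_j\cap Q_k$, there exists $\theta\in[0,\pi)$ such that each of $B_j$ and $B_k$ is definite in $\{\alpha x_-+\beta e^{i\theta}x_+:\alpha,\beta\in\mathbb{R}\}$, where "$B$ is definite in a set $S$" means that $\langle Bx,x\rangle\ge0$ for all $x\in S$ or $\langle Bx,x\rangle\le 0$ for all $x\in S$. Equivalently, in (2) there exists $\theta\in[0,\pi)$ with $\operatorname{Re}\langle B_jx_+,e^{i\theta}x_-\rangle=\operatorname{Re}\langle B_kx_+,e^{i\theta}x_-\rangle=0$ (here $i$ in the exponent is the imaginary unit). *)

theory Defs
  imports "HOL-Analysis.Analysis"
begin

text \<open>
  Complex Hilbert spaces. The inner product is linear in the first and conjugate-linear in the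
  second argument; the norm (hence, through \<^class>\<open>banach\<close>, the topology and completeness)
  is the one induced by it.
\<close>

class complex_hilbert_space = banach +
  fixes scaleC :: "complex \<Rightarrow> 'a \<Rightarrow> 'a"  (infixr \<open>*\<^sub>C\<close> 75)
    and cinner :: "'a \<Rightarrow> 'a \<Rightarrow> complex"
  assumes scaleC_add_right: "a *\<^sub>C (x + y) = a *\<^sub>C x + a *\<^sub>C y"
    and scaleC_add_left: "(a + b) *\<^sub>C x = a *\<^sub>C x + b *\<^sub>C x"
    and scaleC_scaleC: "a *\<^sub>C (b *\<^sub>C x) = (a * b) *\<^sub>C x"
    and scaleC_one: "1 *\<^sub>C x = x"
    and scaleR_eq_scaleC: "r *\<^sub>R x = complex_of_real r *\<^sub>C x"
    and cinner_commute: "cinner x y = cnj (cinner y x)"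
    and cinner_add_left: "cinner (x + y) z = cinner x z + cinner y z"
    and cinner_scaleC_left: "cinner (a *\<^sub>C x) y = a * cinner x y"
    and norm_sq_eq_cinner: "complex_of_real ((norm x)\<^sup>2) = cinner x x"

instantiation complex :: complex_hilbert_space
begin

definition scaleC_complex :: "complex \<Rightarrow> complex \<Rightarrow> complex"
  where "scaleC_complex a x = a * x"

definition cinner_complex :: "complex \<Rightarrow> complex \<Rightarrow> complex"
  where "cinner_complex x y = x * cnj y"

instance
  by standard
    (auto simp: scaleC_complex_def cinner_complex_def algebra_simps scaleR_conv_of_real
      complex_norm_square simp flip: of_real_power)

end

definition bounded_selfadjoint :: "('a::complex_hilbert_space \<Rightarrow> 'a) \<Rightarrow> bool" where
  "bounded_selfadjoint T \<longleftrightarrow>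
     bounded_linear T \<and> (\<forall>c x. T (c *\<^sub>C x) = c *\<^sub>C T x) \<and>
     (\<forall>x y. cinner (T x) y = cinner x (T y))"

text \<open>
  The value \<open>\<langle>T x, x\<rangle>\<close> as a real number. Taking the real part loses nothing for selfadjoint
  \<open>T\<close>, see \<open>of_real_qform\<close> below.
\<close>

definition qform :: "('a::complex_hilbert_space \<Rightarrow> 'a) \<Rightarrow> 'a \<Rightarrow> real" where
  "qform T x = Re (cinner (T x) x)"

lemma of_real_qform:
  assumes "bounded_selfadjoint T"
  shows "complex_of_real (qform T x) = cinner (T x) x"
proof -
  have "cinner (T x) x = cnj (cinner (T x) x)"
    using assms cinner_commute[of "T x" x] by (simp add: bounded_selfadjoint_def)
  then show ?thesis
    by (metis qform_def complex_cnj_cancel_iff Reals_cnj_iff of_real_Re)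
qed

definition nonneg_op :: "('a::complex_hilbert_space \<Rightarrow> 'a) \<Rightarrow> bool" where
  "nonneg_op T \<longleftrightarrow> (\<forall>x. qform T x \<ge> 0)"

definition indefinite :: "('a::complex_hilbert_space \<Rightarrow> 'a) \<Rightarrow> bool" where
  "indefinite T \<longleftrightarrow> (\<exists>x. qform T x > 0) \<and> (\<exists>x. qform T x < 0)"

definition zero_set :: "('a::complex_hilbert_space \<Rightarrow> 'a) \<Rightarrow> 'a set" where
  "zero_set T = {x. qform T x = 0}"

definition pos_set :: "('a::complex_hilbert_space \<Rightarrow> 'a) \<Rightarrow> 'a set" where
  "pos_set T = {x. qform T x > 0}"

definition neg_set :: "('a::complex_hilbert_space \<Rightarrow> 'a) \<Rightarrow> 'a set" where
  "neg_set T = {x. qform T x < 0}"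

definition definite_in :: "('a::complex_hilbert_space \<Rightarrow> 'a) \<Rightarrow> 'a set \<Rightarrow> bool" where
  "definite_in T S \<longleftrightarrow> (\<forall>x\<in>S. qform T x \<ge> 0) \<or> (\<forall>x\<in>S. qform T x \<le> 0)"

text \<open>
  A family \<open>B\<^sub>1, \<dots>, B\<^sub>m\<close> is a function on \<^typ>\<open>nat\<close> of which only the values on
  \<open>{1..m}\<close> matter, and \<open>\<real>\<^sup>m\<close> is the set \<open>{1..m} \<rightarrow>\<^sub>E UNIV\<close> of real functions on \<open>{1..m}\<close>.
\<close>

definition weakly_indefinite :: "nat \<Rightarrow> (nat \<Rightarrow> 'a::complex_hilbert_space \<Rightarrow> 'a) \<Rightarrow> bool" where
  "weakly_indefinite m B \<longleftrightarrow>
     (\<forall>\<mu> \<in> {1..m} \<rightarrow>\<^sub>E (UNIV :: real set).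
        (\<exists>p\<in>{1..m}. \<mu> p \<noteq> 0) \<longrightarrow> indefinite (\<lambda>x. \<Sum>p=1..m. \<mu> p *\<^sub>R B p x))"

definition strongly_indefinite :: "nat \<Rightarrow> (nat \<Rightarrow> 'a::complex_hilbert_space \<Rightarrow> 'a) \<Rightarrow> bool" where
  "strongly_indefinite m B \<longleftrightarrow>
     2 \<le> m \<and> weakly_indefinite m B \<and>
     (\<forall>p\<in>{1..m}. \<forall>j\<in>{1..m}. \<forall>k\<in>{1..m}.
        \<forall>u \<in> pos_set (B p) \<inter> zero_set (B j) \<inter> zero_set (B k).
        \<forall>v \<in> neg_set (B p) \<inter> zero_set (B j) \<inter> zero_set (B k).
          \<exists>\<theta>\<in>{0..<pi}.
            let S = {\<alpha> *\<^sub>R v + \<beta> *\<^sub>R (cis \<theta> *\<^sub>C u) | \<alpha> \<beta>. True}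
            in definite_in (B j) S \<and> definite_in (B k) S)"

definition Omega ::
  "nat \<Rightarrow> ('a::complex_hilbert_space \<Rightarrow> 'a) \<Rightarrow> (nat \<Rightarrow> 'a \<Rightarrow> 'a) \<Rightarrow> (nat \<Rightarrow> real) set" where
  "Omega m A B =
     {l \<in> {1..m} \<rightarrow>\<^sub>E UNIV. nonneg_op (\<lambda>x. A x + (\<Sum>i=1..m. l i *\<^sub>R B i x))}"

end

theory Submission
  imports Defs
begin

text \<open>
  The constraints are eliminated one at a time. Suppose \<open>A \<ge> 0\<close> on \<open>Q\<^sub>1 \<inter> \<dots> \<inter> Q\<^sub>n\<close> and let \<open>u, v\<close> lie
  in \<open>Q\<^sub>1 \<inter> \<dots> \<inter> Q\<^sub>n\<^sub>-\<^sub>1\<close> with \<open>\<langle>B\<^sub>n v, v\<rangle> < 0 < \<langle>B\<^sub>n u, u\<rangle>\<close>. Strong indefiniteness says that the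
  complex numbers \<open>\<langle>B\<^sub>j v, u\<rangle>\<close>, \<open>j < n\<close>, are pairwise, hence all, on one real line through \<open>0\<close>, so one
  rotation \<open>e\<close> puts the whole real plane spanned by \<open>v\<close> and \<open>e u\<close> into \<open>Q\<^sub>1 \<inter> \<dots> \<inter> Q\<^sub>n\<^sub>-\<^sub>1\<close>. On this
  plane \<open>B\<^sub>n\<close> vanishes on two lines, where \<open>A \<ge> 0\<close>, and this yields
  \<open>\<langle>A v, v\<rangle> / \<langle>B\<^sub>n v, v\<rangle> \<le> \<langle>A u, u\<rangle> / \<langle>B\<^sub>n u, u\<rangle>\<close>. A number \<open>-\<lambda>\<close> separating these quotients gives
  \<open>A + \<lambda> B\<^sub>n \<ge> 0\<close> on \<open>Q\<^sub>1 \<inter> \<dots> \<inter> Q\<^sub>n\<^sub>-\<^sub>1\<close>. Both kinds of quotients exist: otherwise the statement for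
  \<open>n - 1\<close> constraints, applied to \<open>\<plusminus>B\<^sub>n\<close> in place of \<open>A\<close>, would contradict weak indefiniteness.
\<close>

section \<open>Algebra of the inner product and of the quadratic forms\<close>

lemma cinner_add_right: "cinner x (y + z) = cinner x y + cinner x z"
  by (metis cinner_commute cinner_add_left complex_cnj_add)

lemma cinner_scaleC_right: "cinner x (a *\<^sub>C y) = cnj a * cinner x y"
  by (metis cinner_commute cinner_scaleC_left complex_cnj_mult)

lemma bounded_selfadjoint_add_scaleR:
  assumes "bounded_selfadjoint S" "bounded_selfadjoint T"
  shows "bounded_selfadjoint (\<lambda>x. S x + r *\<^sub>R T x)"
proof -
  have "bounded_linear (\<lambda>x. S x + r *\<^sub>R T x)"
    using assms by (simp add: bounded_selfadjoint_def bounded_linear_add bounded_linear_const_scaleR)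
  then show ?thesis
    using assms unfolding bounded_selfadjoint_def
    by (simp add: scaleR_eq_scaleC scaleC_scaleC scaleC_add_right mult.commute cinner_add_left
        cinner_scaleC_left cinner_add_right cinner_scaleC_right)
qed

lemma qform_add_scaleR:
  "qform (\<lambda>x. S x + r *\<^sub>R T x) x = qform S x + r * qform T x"
  by (simp add: qform_def cinner_add_left cinner_scaleC_left scaleR_eq_scaleC)

lemma qform_sum_scaleR:
  assumes "finite I"
  shows "qform (\<lambda>x. \<Sum>i\<in>I. l i *\<^sub>R T i x) x = (\<Sum>i\<in>I. l i * qform (T i) x)"
  using assms
proof (induction I rule: finite_induct)
  case empty
  have "cinner 0 x = 0"
    using cinner_add_left[of 0 0 x] by simp
  then show ?case
    by (simp add: qform_def)
next
  case (insert i I)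
  then show ?case
    using qform_add_scaleR[of "\<lambda>x. \<Sum>i\<in>I. l i *\<^sub>R T i x" "l i" "T i" x]
    by (simp add: add.commute)
qed

lemma qform_scaleC:
  assumes "bounded_selfadjoint T"
  shows "qform T (a *\<^sub>C x) = (cmod a)\<^sup>2 * qform T x"
proof -
  have "cinner (T (a *\<^sub>C x)) (a *\<^sub>C x) = a * cnj a * cinner (T x) x"
    using assms by (simp add: bounded_selfadjoint_def cinner_scaleC_left cinner_scaleC_right)
  then show ?thesis
    by (simp add: qform_def complex_norm_square[symmetric] del: of_real_power)
qed

text \<open>Selfadjointness makes the two cross terms conjugate, so only twice a real part survives.
  No \<open>cmod e = 1\<close> is imposed, which leaves the factor
  \<open>(cmod e)\<^sup>2\<close>.\<close>

lemma qform_real_combination: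
  assumes "bounded_selfadjoint T"
  shows "qform T (\<alpha> *\<^sub>R v + \<beta> *\<^sub>R (e *\<^sub>C u)) =
    \<alpha>\<^sup>2 * qform T v + 2 * \<alpha> * \<beta> * Re (cnj e * cinner (T v) u) + \<beta>\<^sup>2 * (cmod e)\<^sup>2 * qform T u"
proof -
  define w where "w = e *\<^sub>C u"
  have add: "T (x + y) = T x + T y" for x y
    using assms by (simp add: bounded_selfadjoint_def bounded_linear.linear linear_add)
  have scale: "T (c *\<^sub>C x) = c *\<^sub>C T x" for c x
    using assms by (simp add: bounded_selfadjoint_def)
  have "cinner (T w) v = cnj (cinner (T v) w)"
    using assms cinner_commute by (metis bounded_selfadjoint_def)
  then have "qform T (\<alpha> *\<^sub>R v + \<beta> *\<^sub>R w) =
      \<alpha>\<^sup>2 * qform T v + 2 * \<alpha> * \<beta> * Re (cinner (T v) w) + \<beta>\<^sup>2 * qform T w"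
    by (simp add: qform_def scaleR_eq_scaleC add scale cinner_add_right cinner_scaleC_right cinner_add_left cinner_scaleC_left
        algebra_simps power2_eq_square)
  moreover have "cinner (T v) w = cnj e * cinner (T v) u"
    by (simp add: w_def cinner_scaleC_right)
  moreover have "qform T w = (cmod e)\<^sup>2 * qform T u"
    using qform_scaleC[OF assms] by (simp add: w_def)
  ultimately show ?thesis
    by (simp add: w_def)
qed

section \<open>From definiteness on planes to one common rotation\<close>

text \<open>On this plane the form reduces to \<open>2 * \<alpha> * \<beta> * r\<close>, which takes
  both signs unless \<open>r = 0\<close>.\<close>

lemma definite_in_real_plane_imp:
  assumes T: "bounded_selfadjoint T" and "qform T u = 0" "qform T v = 0"
    and "definite_in T {\<alpha> *\<^sub>R v + \<beta> *\<^sub>R (e *\<^sub>C u) | \<alpha> \<beta>. True}"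
  shows "Re (cnj e * cinner (T v) u) = 0"
proof -
  define r where "r = Re (cnj e * cinner (T v) u)"
  have val: "qform T (\<alpha> *\<^sub>R v + \<beta> *\<^sub>R (e *\<^sub>C u)) = 2 * \<alpha> * \<beta> * r" for \<alpha> \<beta>
    using qform_real_combination[OF T] assms(2,3) by (simp add: r_def)
  have "(\<forall>\<alpha> \<beta>. 0 \<le> 2 * \<alpha> * \<beta> * r) \<or> (\<forall>\<alpha> \<beta>. 2 * \<alpha> * \<beta> * r \<le> 0)"
    using assms(4) unfolding definite_in_def val[symmetric] by blast
  then have "r = 0"
  proof
    assume "\<forall>\<alpha> \<beta>. 0 \<le> 2 * \<alpha> * \<beta> * r"
    from this[rule_format, of 1 1] this[rule_format, of 1 "-1"] show "r = 0" by simp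
  next
    assume "\<forall>\<alpha> \<beta>. 2 * \<alpha> * \<beta> * r \<le> 0"
    from this[rule_format, of 1 1] this[rule_format, of 1 "-1"] show "r = 0" by simp
  qed
  then show ?thesis by (simp add: r_def)
qed

text \<open>\<open>Re (cnj e * b j) = 0\<close> means that \<open>b j\<close> is orthogonal to
  \<open>e\<close> in the real plane. A nonzero \<open>b k\<close> fixes the line containing all the
  others, and \<open>\<i> * b k\<close> is perpendicular to it.\<close>

lemma common_rotation:
  fixes b :: "'i \<Rightarrow> complex"
  assumes "\<And>j k. j \<in> J \<Longrightarrow> k \<in> J \<Longrightarrow> \<exists>e. e \<noteq> 0 \<and> Re (cnj e * b j) = 0 \<and> Re (cnj e * b k) = 0"
  obtains e where "e \<noteq> 0" "\<And>j. j \<in> J \<Longrightarrow> Re (cnj e * b j) = 0"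
proof (cases "\<forall>j\<in>J. b j = 0")
  case True
  then show ?thesis using that[of 1] by simp
next
  case False
  then obtain k where k: "k \<in> J" "b k \<noteq> 0" by blast
  have "Re (cnj (\<i> * b k) * b j) = 0" if "j \<in> J" for j
  proof -
    obtain e where "e \<noteq> 0" and e: "Re (cnj e * b j) = 0" "Re (cnj e * b k) = 0"
      using assms \<open>j \<in> J\<close> k(1) by blast
    \<comment> \<open>Up to sign, \<open>d\<close> is the determinant of the linear system satisfied
      by \<open>(Re e, Im e)\<close>, so a nonzero solution forces \<open>d = 0\<close>. It also
      equals the real part to be computed.\<close>
    define d where "d = Re (b k) * Im (b j) - Im (b k) * Re (b j)"
    have "Re e * Re (b j) + Im e * Im (b j) = 0" "Re e * Re (b k) + Im e * Im (b k) = 0"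
      using e by simp_all
    then have "Re e * d = 0 \<and> Im e * d = 0"
      unfolding d_def by algebra
    then have "d = 0"
      using \<open>e \<noteq> 0\<close> by (auto simp: complex_eq_iff)
    then show ?thesis
      by (simp add: d_def algebra_simps)
  qed
  then show ?thesis using that[of "\<i> * b k"] k(2) by simp
qed

section \<open>Real inequalities\<close>

lemma binary_quadratic_nonneg:
  fixes a0 a1 a2 c d r :: real
  assumes "c > 0" "d > 0"
    and nonneg: "\<And>t. d + 2 * t * r - t\<^sup>2 * c = 0 \<Longrightarrow> 0 \<le> a0 + 2 * t * a1 + t\<^sup>2 * a2"
  shows "0 \<le> c * a0 + d * a2"
proof -
  define D where "D = sqrt (r\<^sup>2 + c * d)"
  have D2: "D\<^sup>2 = r\<^sup>2 + c * d"
    using assms(1,2) by (simp add: D_def)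
  have "\<bar>r\<bar> < D"
    unfolding D_def using assms(1,2) by (intro real_less_rsqrt) simp
  \<comment> \<open>The roots of the quadratic in the hypothesis are \<open>s\<close> and
    \<open>- t\<close>; \<open>prod\<close> and \<open>diff\<close> below are Vieta's
    relations.\<close>
  define s t where "s = (r + D) / c" and "t = (D - r) / c"
  have st: "s > 0" "t > 0"
    using \<open>\<bar>r\<bar> < D\<close> assms(1) by (simp_all add: s_def t_def)
  have prod: "c * (s * t) = d"
    using assms(1) D2 by (simp add: s_def t_def field_simps power2_eq_square)
  have diff: "c * (s - t) = 2 * r"
    using assms(1) by (simp add: s_def t_def field_simps)
  have "d + 2 * s * r - s\<^sup>2 * c = c * (s * t) + s * (c * (s - t)) - s\<^sup>2 * c"
    unfolding prod diff by simp
  then have "d + 2 * s * r - s\<^sup>2 * c = 0"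
    by (simp add: algebra_simps power2_eq_square)
  moreover have "d + 2 * (- t) * r - (- t)\<^sup>2 * c = c * (s * t) - t * (c * (s - t)) - t\<^sup>2 * c"
    unfolding prod diff by simp
  then have "d + 2 * (- t) * r - (- t)\<^sup>2 * c = 0"
    by (simp add: algebra_simps power2_eq_square)
  ultimately have 1: "0 \<le> a0 + 2 * s * a1 + s\<^sup>2 * a2" "0 \<le> a0 - 2 * t * a1 + t\<^sup>2 * a2"
    using nonneg[of s] nonneg[of "- t"] by simp_all
  \<comment> \<open>The weights \<open>t\<close> and \<open>s\<close> cancel the linear coefficient
    \<open>a1\<close>.\<close>
  have "0 \<le> t * (a0 + 2 * s * a1 + s\<^sup>2 * a2) + s * (a0 - 2 * t * a1 + t\<^sup>2 * a2)"
    using 1 st by simp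
  also have "\<dots> = (s + t) * (a0 + s * t * a2)"
    by algebra
  finally have "0 \<le> a0 + s * t * a2"
    using st by (simp add: zero_le_mult_iff)
  then have "0 \<le> c * (a0 + s * t * a2)"
    using assms(1) by simp
  also have "\<dots> = c * a0 + d * a2"
    unfolding prod[symmetric] by (simp add: algebra_simps)
  finally show ?thesis .
qed

text \<open>Dividing \<open>pair\<close> by \<open>g u * g v < 0\<close> shows that quotients
  \<open>f v / g v\<close> with \<open>g v < 0\<close> lie below those with \<open>g u > 0\<close>.
  Their supremum separates the two kinds; \<open>v0\<close> makes it a supremum of a nonempty set
  and \<open>u0\<close> bounds that set.\<close>

lemma multiplier_exists:
  fixes f g :: "'a \<Rightarrow> real"
  assumes "\<And>x. x \<in> M \<Longrightarrow> g x = 0 \<Longrightarrow> 0 \<le> f x"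
    and "u0 \<in> M" "g u0 > 0" "v0 \<in> M" "g v0 < 0"
    and pair: "\<And>u v. u \<in> M \<Longrightarrow> v \<in> M \<Longrightarrow> g u > 0 \<Longrightarrow> g v < 0 \<Longrightarrow> 0 \<le> g u * f v - g v * f u"
  obtains l where "\<And>x. x \<in> M \<Longrightarrow> 0 \<le> f x + l * g x"
proof -
  define V where "V = (\<lambda>v. f v / g v) ` {v \<in> M. g v < 0}"
  have ub: "s \<le> f u / g u" if "s \<in> V" "u \<in> M" "g u > 0" for s u
    using that pair by (auto simp: V_def field_simps)
  have "V \<noteq> {}" using assms(4,5) by (auto simp: V_def)
  have "bdd_above V" using ub assms(2,3) by (auto simp: bdd_above_def)
  have "0 \<le> f x + - Sup V * g x" if "x \<in> M" for x
  proof -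
    consider "g x = 0" | "g x > 0" | "g x < 0" by linarith
    then show ?thesis
    proof cases
      case 1
      then show ?thesis using assms(1) that by simp
    next
      case 2
      then have "Sup V \<le> f x / g x"
        using \<open>V \<noteq> {}\<close> ub that by (intro cSup_least) auto
      then show ?thesis using 2 by (simp add: field_simps)
    next
      case 3
      then have "f x / g x \<le> Sup V"
        using \<open>bdd_above V\<close> that by (intro cSup_upper) (auto simp: V_def)
      then show ?thesis using 3 by (simp add: field_simps)
    qed
  qed
  then show ?thesis by (rule that)
qed

section \<open>Elimination of the constraints\<close>

lemma weakly_indefiniteD:
  assumes "weakly_indefinite m B" "p \<in> {1..m}" "l p \<noteq> 0"
  obtains x where "(\<Sum>i=1..m. l i * qform (B i) x) < 0"
proof -
  let ?\<mu> = "restrict l {1..m}"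
  have "?\<mu> \<in> {1..m} \<rightarrow>\<^sub>E UNIV" "\<exists>q\<in>{1..m}. ?\<mu> q \<noteq> 0"
    using assms(2,3) by auto
  with assms(1) have "indefinite (\<lambda>x. \<Sum>i=1..m. ?\<mu> i *\<^sub>R B i x)"
    unfolding weakly_indefinite_def by blast
  then obtain x where "qform (\<lambda>x. \<Sum>i=1..m. ?\<mu> i *\<^sub>R B i x) x < 0"
    by (auto simp: indefinite_def)
  then show ?thesis
    using that by (simp add: qform_sum_scaleR)
qed

text \<open>The definition treats two indices at a time, with an angle that may depend on them;
  \<open>common_rotation\<close> merges these angles.\<close>

lemma strongly_indefinite_common_rotation:
  assumes sa: "\<And>i. i \<in> {1..m} \<Longrightarrow> bounded_selfadjoint (B i)"
    and si: "strongly_indefinite m B" and "p \<in> {1..m}" "J \<subseteq> {1..m}"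
    and u: "\<And>j. j \<in> J \<Longrightarrow> qform (B j) u = 0" "qform (B p) u > 0"
    and v: "\<And>j. j \<in> J \<Longrightarrow> qform (B j) v = 0" "qform (B p) v < 0"
  obtains e where "e \<noteq> 0" "\<And>j. j \<in> J \<Longrightarrow> Re (cnj e * cinner (B j v) u) = 0"
proof -
  have pairwise: "\<exists>e. e \<noteq> 0 \<and> Re (cnj e * cinner (B j v) u) = 0 \<and> Re (cnj e * cinner (B k v) u) = 0"
    if jk: "j \<in> J" "k \<in> J" for j k
  proof -
    have "u \<in> pos_set (B p) \<inter> zero_set (B j) \<inter> zero_set (B k)"
      "v \<in> neg_set (B p) \<inter> zero_set (B j) \<inter> zero_set (B k)"
      using u v jk by (simp_all add: pos_set_def neg_set_def zero_set_def)
    moreover have "j \<in> {1..m}" "k \<in> {1..m}" using jk assms(4) by auto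
    ultimately obtain \<theta> where
      "definite_in (B j) {\<alpha> *\<^sub>R v + \<beta> *\<^sub>R (cis \<theta> *\<^sub>C u) | \<alpha> \<beta>. True}"
      "definite_in (B k) {\<alpha> *\<^sub>R v + \<beta> *\<^sub>R (cis \<theta> *\<^sub>C u) | \<alpha> \<beta>. True}"
      using si \<open>p \<in> {1..m}\<close> unfolding strongly_indefinite_def Let_def by meson
    then have "Re (cnj (cis \<theta>) * cinner (B j v) u) = 0" "Re (cnj (cis \<theta>) * cinner (B k v) u) = 0"
      using definite_in_real_plane_imp sa u(1) v(1) jk \<open>j \<in> {1..m}\<close> \<open>k \<in> {1..m}\<close> by blast+
    then show ?thesis
      using cis_neq_zero by blast
  qed
  show ?thesis
    using common_rotation[of J "\<lambda>j. cinner (B j v) u", OF pairwise] that by metis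
qed

lemma nonneg_pair:
  assumes A: "bounded_selfadjoint A" and T: "bounded_selfadjoint T"
    and sa: "\<And>j. j \<in> J \<Longrightarrow> bounded_selfadjoint (B j)"
    and u: "\<And>j. j \<in> J \<Longrightarrow> qform (B j) u = 0" "qform T u > 0"
    and v: "\<And>j. j \<in> J \<Longrightarrow> qform (B j) v = 0" "qform T v < 0"
    and e: "e \<noteq> 0" "\<And>j. j \<in> J \<Longrightarrow> Re (cnj e * cinner (B j v) u) = 0"
    and nonneg: "\<And>x. \<lbrakk>\<And>j. j \<in> J \<Longrightarrow> qform (B j) x = 0; qform T x = 0\<rbrakk> \<Longrightarrow> 0 \<le> qform A x"
  shows "0 \<le> qform T u * qform A v - qform T v * qform A u"
proof -
  let ?E = "(cmod e)\<^sup>2"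
  have E: "?E > 0" using e(1) by simp
  \<comment> \<open>The coefficient of \<open>e *\<^sub>C u\<close> is normalised to 1, and
    \<open>t\<close> is that of \<open>v\<close>. The roots in \<open>t\<close> are the points where
    \<open>T\<close> vanishes on this affine line, so \<open>nonneg\<close> applies there.\<close>
  have "0 \<le> (- qform T v) * (?E * qform A u) + (?E * qform T u) * qform A v"
  proof (rule binary_quadratic_nonneg)
    fix t
    assume t: "?E * qform T u + 2 * t * Re (cnj e * cinner (T v) u) - t\<^sup>2 * (- qform T v) = 0"
    have "0 \<le> qform A (t *\<^sub>R v + 1 *\<^sub>R (e *\<^sub>C u))"
    proof (rule nonneg)
      show "qform (B j) (t *\<^sub>R v + 1 *\<^sub>R (e *\<^sub>C u)) = 0" if "j \<in> J" for j
        using that sa u(1) v(1) e(2) by (subst qform_real_combination) auto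
      show "qform T (t *\<^sub>R v + 1 *\<^sub>R (e *\<^sub>C u)) = 0"
        unfolding qform_real_combination[OF T] using t by simp
    qed
    then show "0 \<le> ?E * qform A u + 2 * t * Re (cnj e * cinner (A v) u) + t\<^sup>2 * qform A v"
      by (subst (asm) qform_real_combination[OF A]) simp
  qed (use E u v in \<open>auto intro: mult_pos_pos\<close>)
  then have "0 \<le> ?E * (qform T u * qform A v - qform T v * qform A u)"
    by (simp add: algebra_simps)
  then show ?thesis
    using E by (simp add: zero_le_mult_iff)
qed

text \<open>The induction keeps \<open>A\<close> arbitrary, since its hypothesis is used both for
  multiples of the last form and for \<open>A\<close> plus a multiple of it.\<close>

lemma multipliers_exist:
  assumes sa: "\<And>i. i \<in> {1..m} \<Longrightarrow> bounded_selfadjoint (B i)"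
    and si: "strongly_indefinite m B"
    and "n \<le> m" "bounded_selfadjoint A"
    and "\<And>x. (\<And>i. i \<in> {1..n} \<Longrightarrow> qform (B i) x = 0) \<Longrightarrow> 0 \<le> qform A x"
  shows "\<exists>l. \<forall>x. 0 \<le> qform A x + (\<Sum>i=1..n. l i * qform (B i) x)"
  using assms(3-)
proof (induction n arbitrary: A)
  case 0
  then show ?case by simp
next
  case (Suc n)
  let ?p = "Suc n"
  define M where "M = {x. \<forall>i\<in>{1..n}. qform (B i) x = 0}"
  have p: "?p \<in> {1..m}" using Suc.prems(1) by simp
  have sign: "\<exists>x\<in>M. s * qform (B ?p) x < 0" if "s \<noteq> 0" for s :: real
  proof (rule ccontr)
    assume contra: "\<not> (\<exists>x\<in>M. s * qform (B ?p) x < 0)"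
    \<comment> \<open>This is \<open>s\<close> times \<open>B ?p\<close>, written as a sum so that
      the lemmas on \<open>S x + r *\<^sub>R T x\<close> apply.\<close>
    let ?C = "\<lambda>x. B ?p x + (s - 1) *\<^sub>R B ?p x"
    have C: "qform ?C x = s * qform (B ?p) x" for x
      unfolding qform_add_scaleR by (simp add: algebra_simps)
    have "\<exists>l. \<forall>x. 0 \<le> qform ?C x + (\<Sum>i=1..n. l i * qform (B i) x)"
    proof (rule Suc.IH)
      show "bounded_selfadjoint ?C"
        using sa p by (intro bounded_selfadjoint_add_scaleR) auto
      fix x assume "\<And>i. i \<in> {1..n} \<Longrightarrow> qform (B i) x = 0"
      then have "x \<in> M" by (simp add: M_def)
      then show "0 \<le> qform ?C x"
        unfolding C using contra by force
    qed (use Suc.prems(1) in simp)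
    then obtain l where l: "\<And>x. 0 \<le> s * qform (B ?p) x + (\<Sum>i=1..n. l i * qform (B i) x)"
      unfolding C by blast
    \<comment> \<open>Padding with zeros beyond \<open>?p\<close> gives a nontrivial combination of
      the full family that is nonnegative, against weak indefiniteness.\<close>
    define \<mu> where "\<mu> i = (if i \<le> n then l i else if i = ?p then s else 0)" for i
    have "weakly_indefinite m B" using si by (simp add: strongly_indefinite_def)
    moreover have "\<mu> ?p \<noteq> 0" using that by (simp add: \<mu>_def)
    ultimately obtain x where x: "(\<Sum>i=1..m. \<mu> i * qform (B i) x) < 0"
      using p weakly_indefiniteD by blast
    have "(\<Sum>i=1..m. \<mu> i * qform (B i) x) = (\<Sum>i=1..?p. \<mu> i * qform (B i) x)"
      using Suc.prems(1) by (intro sum.mono_neutral_right) (auto simp: \<mu>_def)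
    also have "\<dots> = s * qform (B ?p) x + (\<Sum>i=1..n. l i * qform (B i) x)"
      by (simp add: \<mu>_def)
    finally show False using x l[of x] by simp
  qed
  obtain u0 v0 where uv0: "u0 \<in> M" "qform (B ?p) u0 > 0" "v0 \<in> M" "qform (B ?p) v0 < 0"
    using sign[of 1] sign[of "-1"] by auto
  have nonneg: "0 \<le> qform A x" if "x \<in> M" "qform (B ?p) x = 0" for x
    using that by (intro Suc.prems(3)) (auto simp: M_def le_Suc_eq)
  have pair: "0 \<le> qform (B ?p) u * qform A v - qform (B ?p) v * qform A u"
    if u: "u \<in> M" "qform (B ?p) u > 0" and v: "v \<in> M" "qform (B ?p) v < 0" for u v
  proof -
    have J: "{1..n} \<subseteq> {1..m}" using Suc.prems(1) by auto
    have uv: "qform (B j) u = 0" "qform (B j) v = 0" if "j \<in> {1..n}" for j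
      using that u(1) v(1) by (auto simp: M_def)
    obtain e where e: "e \<noteq> 0" "\<And>j. j \<in> {1..n} \<Longrightarrow> Re (cnj e * cinner (B j v) u) = 0"
      using strongly_indefinite_common_rotation[OF sa si p J uv(1) u(2) uv(2) v(2)] by blast
    show ?thesis
    proof (rule nonneg_pair[where J = "{1..n}" and B = B, OF Suc.prems(2) sa[OF p] _ _ _ _ _ e])
      show "0 \<le> qform A x"
        if "\<And>j. j \<in> {1..n} \<Longrightarrow> qform (B j) x = 0" "qform (B ?p) x = 0" for x
        using that by (intro nonneg) (auto simp: M_def)
    qed (use uv u v sa J in auto)
  qed
  obtain l where l: "\<And>x. x \<in> M \<Longrightarrow> 0 \<le> qform A x + l * qform (B ?p) x"
    using multiplier_exists[of M "qform (B ?p)" "qform A", OF nonneg uv0] pair by blast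
  have "\<exists>k. \<forall>x. 0 \<le> qform (\<lambda>x. A x + l *\<^sub>R B ?p x) x + (\<Sum>i=1..n. k i * qform (B i) x)"
  proof (rule Suc.IH)
    show "bounded_selfadjoint (\<lambda>x. A x + l *\<^sub>R B ?p x)"
      using Suc.prems(2) sa p by (intro bounded_selfadjoint_add_scaleR) auto
    show "0 \<le> qform (\<lambda>x. A x + l *\<^sub>R B ?p x) x"
      if "\<And>i. i \<in> {1..n} \<Longrightarrow> qform (B i) x = 0" for x
      using l that by (simp add: qform_add_scaleR M_def)
  qed (use Suc.prems(1) in simp)
  then obtain k where k: "0 \<le> qform A x + l * qform (B ?p) x + (\<Sum>i=1..n. k i * qform (B i) x)" for x
    unfolding qform_add_scaleR by blast
  have "(\<Sum>i=1..?p. (k(?p := l)) i * qform (B i) x) =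
      l * qform (B ?p) x + (\<Sum>i=1..n. k i * qform (B i) x)" for x
    by (simp add: add.commute)
  then have "\<forall>x. 0 \<le> qform A x + (\<Sum>i=1..?p. (k(?p := l)) i * qform (B i) x)"
    using k by (simp only: add.assoc simp_thms)
  then show ?case by blast
qed

theorem theorem4p6:
  fixes A :: "'a::complex_hilbert_space \<Rightarrow> 'a"
    and B :: "nat \<Rightarrow> 'a \<Rightarrow> 'a"
    and m :: nat
  assumes "m \<ge> 3"
    and "bounded_selfadjoint A"
    and "\<And>i. i \<in> {1..m} \<Longrightarrow> bounded_selfadjoint (B i)"
    and "strongly_indefinite m B"
  shows "(\<forall>x \<in> (\<Inter>i\<in>{1..m}. zero_set (B i)). qform A x \<ge> 0) \<longleftrightarrow> Omega m A B \<noteq> {}"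
proof
  have val: "qform (\<lambda>x. A x + (\<Sum>i=1..m. l i *\<^sub>R B i x)) x =
      qform A x + (\<Sum>i=1..m. l i * qform (B i) x)" for l x
    using qform_add_scaleR[of A 1 "\<lambda>x. \<Sum>i=1..m. l i *\<^sub>R B i x" x] by (simp add: qform_sum_scaleR)
  {
    assume "\<forall>x \<in> (\<Inter>i\<in>{1..m}. zero_set (B i)). qform A x \<ge> 0"
    then obtain l where "\<And>x. 0 \<le> qform A x + (\<Sum>i=1..m. l i * qform (B i) x)"
      using multipliers_exist[OF assms(3,4) order_refl assms(2)] by (auto simp: zero_set_def)
    \<comment> \<open>\<open>Omega\<close> contains only extensional functions, hence the
      restriction.\<close>
    then have "restrict l {1..m} \<in> Omega m A B"
      unfolding Omega_def nonneg_op_def mem_Collect_eq val by simp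
    then show "Omega m A B \<noteq> {}" by blast
  next
    assume "Omega m A B \<noteq> {}"
    then obtain l where l: "\<And>x. 0 \<le> qform A x + (\<Sum>i=1..m. l i * qform (B i) x)"
      unfolding Omega_def nonneg_op_def val by blast
    show "\<forall>x \<in> (\<Inter>i\<in>{1..m}. zero_set (B i)). qform A x \<ge> 0"
    proof
      fix x assume "x \<in> (\<Inter>i\<in>{1..m}. zero_set (B i))"
      then have "(\<Sum>i=1..m. l i * qform (B i) x) = 0"
        by (intro sum.neutral) (auto simp: zero_set_def)
      then show "0 \<le> qform A x" using l[of x] by simp
    qed
  }
qed

end
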